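(* Suppose an online caching algorithm achieves, for arbitrary cache size $k$, competitive ratio at most $f(\frac{\eta}{\mathrm{OPT}})$ whenever it is provided with predictions having error at most $\eta$ with respect to an optimal offline algorithm. Then $f(x)=\Omega(\log x)$ as $x\to\infty$.
   Context: Caching: a cache holds $k$ pages; requests to pages arrive online; a request to a page not in the cache (page fault) forces loading it, possibly evicting another page, at cost $1$. As a metrical task system, states are cache configurations (sets of $k$ pages) with distance $|X\setminus Y|$. Predictions are predicted configurations $P_t$ at each time $t$; the error with respect to an offline algorithm with configurations $O_t$ is $\eta=\sum_t|P_t\setminus O_t|$. $\mathrm{OPT}$ denotes the optimal offline cost. *)

theory Defs
  imports "HOL-Probability.Probability" "HOL-Library.Landau_Symbols"
begin

text \<open>Pages are drawn from a countably infinite universe. A finite universe is covered by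
  restricting the requests and predictions, and as there are only countably many configurations,
  a \<^type>\<open>pmf\<close> is the most general probability distribution on them.\<close>

type_synonym page = nat
type_synonym config = "page set"

definition configs :: "nat \<Rightarrow> config set" where
  "configs k = {X. finite X \<and> card X = k}"

definition config_dist :: "config \<Rightarrow> config \<Rightarrow> nat" where
  "config_dist X Y = card (X - Y)"

text \<open>Entry \<open>t\<close> of a schedule is the configuration in which request \<open>t\<close> is served; it has to
  contain the requested page. The initial configuration is not part of the schedule.\<close>

definition schedules :: "nat \<Rightarrow> page list \<Rightarrow> config list set" where
  "schedules k rs =
     {Xs. length Xs = length rs \<and> (\<forall>t<length rs. Xs ! t \<in> configs k \<and> rs ! t \<in> Xs ! t)}"

primrec cost :: "config \<Rightarrow> config list \<Rightarrow> nat" where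
  "cost C [] = 0"
| "cost C (X # Xs) = config_dist C X + cost X Xs"

definition OPT :: "nat \<Rightarrow> config \<Rightarrow> page list \<Rightarrow> nat" where
  "OPT k C rs = (INF Xs\<in>schedules k rs. cost C Xs)"

definition optimal_schedule :: "nat \<Rightarrow> config \<Rightarrow> page list \<Rightarrow> config list \<Rightarrow> bool" where
  "optimal_schedule k C rs Os \<longleftrightarrow> Os \<in> schedules k rs \<and> cost C Os = OPT k C rs"

text \<open>A predicted configuration need not contain the page requested at that time.\<close>

definition predictions :: "nat \<Rightarrow> page list \<Rightarrow> config list set" where
  "predictions k rs = {Ps. length Ps = length rs \<and> set Ps \<subseteq> configs k}"

definition prediction_error :: "config list \<Rightarrow> config list \<Rightarrow> nat" where
  "prediction_error Ps Os = (\<Sum>t<length Os. config_dist (Ps ! t) (Os ! t))"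

text \<open>A randomized algorithm is given the cache size, the initial configuration, the requests and
  predictions up to and including the current one, and the configurations it has chosen so far. It
  returns the distribution of its next configuration. Point masses give the deterministic
  algorithms.\<close>

type_synonym caching_algorithm =
  "nat \<Rightarrow> config \<Rightarrow> (page \<times> config) list \<Rightarrow> config list \<Rightarrow> config pmf"

primrec run_steps ::
    "caching_algorithm \<Rightarrow> nat \<Rightarrow> config \<Rightarrow> (page \<times> config) list \<Rightarrow> nat \<Rightarrow> config list pmf" where
  "run_steps A k C ins 0 = return_pmf []"
| "run_steps A k C ins (Suc t) =
     bind_pmf (run_steps A k C ins t)
       (\<lambda>Xs. map_pmf (\<lambda>X. Xs @ [X]) (A k C (take (Suc t) ins) Xs))"

definition run ::
    "caching_algorithm \<Rightarrow> nat \<Rightarrow> config \<Rightarrow> page list \<Rightarrow> config list \<Rightarrow> config list pmf" where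
  "run A k C rs Ps = run_steps A k C (zip rs Ps) (length rs)"

definition online_caching_algorithm :: "caching_algorithm \<Rightarrow> bool" where
  "online_caching_algorithm A \<longleftrightarrow>
     (\<forall>k\<ge>1. \<forall>C\<in>configs k. \<forall>rs. \<forall>Ps\<in>predictions k rs.
        set_pmf (run A k C rs Ps) \<subseteq> schedules k rs)"

text \<open>For an online caching algorithm the cost of a run is bounded (by \<open>k\<close> times the number of
  requests), so this expectation exists.\<close>

definition expected_cost ::
    "caching_algorithm \<Rightarrow> nat \<Rightarrow> config \<Rightarrow> page list \<Rightarrow> config list \<Rightarrow> real" where
  "expected_cost A k C rs Ps =
     measure_pmf.expectation (run A k C rs Ps) (\<lambda>Xs. real (cost C Xs))"

text \<open>As usual for the competitive ratio, an additive constant \<open>\<alpha>\<close> is allowed that may depend on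
  the cache size and the initial configuration, but not on the requests and predictions.
  Inputs with optimal cost \<open>0\<close>, where \<open>\<eta> / OPT\<close> is undefined, are exempt.\<close>

definition achieves_competitive_ratio :: "caching_algorithm \<Rightarrow> (real \<Rightarrow> real) \<Rightarrow> bool" where
  "achieves_competitive_ratio A f \<longleftrightarrow>
     (\<forall>k\<ge>1. \<forall>C\<in>configs k. \<exists>\<alpha>::real. \<forall>rs. \<forall>Ps\<in>predictions k rs. \<forall>Os. \<forall>\<eta>::real.
        optimal_schedule k C rs Os \<and> OPT k C rs > 0 \<and> real (prediction_error Ps Os) \<le> \<eta> \<longrightarrow>
        expected_cost A k C rs Ps \<le> f (\<eta> / real (OPT k C rs)) * real (OPT k C rs) + \<alpha>)"

end

theory Submission
  imports Defs
begin

text \<open>Predictions carrying no information have error at most \<open>k\<close> per request, so it suffices to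
  prove the logarithmic lower bound for randomized paging with requests for which the optimum
  stays at least polynomial in \<open>1/k\<close> per request. Against the constant prediction \<open>C\<close> the
  adversary proceeds in phases. A phase starts in a configuration \<open>D\<close> of the offline player, picks
  a never requested page \<open>v\<close>, and grows a set \<open>M\<close> from \<open>{v}\<close> to \<open>k\<close> pages of \<open>U = D \<union> {v}\<close>: it
  requests all pages of \<open>M\<close> followed by the page of \<open>U - M\<close> for which the algorithm is most likely
  to miss one of these pages. As the algorithm always misses one of the \<open>k + 1\<close> pages of \<open>U\<close>, this
  costs it \<open>1 / card (U - M)\<close> in expectation, hence \<open>harm k - 1\<close> in a phase, whereas the offline
  player moves to the final \<open>M\<close> at cost \<open>1\<close>. The \<open>n\<close> fresh pages make \<open>n\<close> also a lower bound for
  the optimum of \<open>n\<close> phases. A phase has at most \<open>k^2\<close> requests, which gives \<open>f x \<ge> harm k - 1\<close>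
  for all \<open>x \<ge> k^3\<close>.\<close>

section \<open>Costs of schedules and the offline optimum\<close>

lemma configs_Diff_card_eq:
  assumes "X \<in> configs k" "Y \<in> configs k"
  shows "card (X - Y) = card (Y - X)"
  using assms card_Diff_subset_Int[of X Y] card_Diff_subset_Int[of Y X]
  by (simp add: configs_def Int_commute)

lemma configs_card_Diff_le: "X \<in> configs k \<Longrightarrow> card (X - Y) \<le> k"
  by (auto simp: configs_def intro!: card_mono)

lemma schedules_set: "Xs \<in> schedules k rs \<Longrightarrow> set Xs \<subseteq> configs k"
  by (auto simp: schedules_def in_set_conv_nth)

lemma last_in_configs:
  "C \<in> configs k \<Longrightarrow> set Xs \<subseteq> configs k \<Longrightarrow> last (C # Xs) \<in> configs k"
  by (rule subsetD[OF _ last_in_set]) auto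

lemma schedules_length: "Xs \<in> schedules k rs \<Longrightarrow> length Xs = length rs"
  by (simp add: schedules_def)

lemma schedules_requests: "Xs \<in> schedules k rs \<Longrightarrow> set rs \<subseteq> \<Union> (set Xs)"
  by (fastforce simp: schedules_def in_set_conv_nth)

lemma schedules_append:
  "Xs \<in> schedules k rs \<Longrightarrow> Ys \<in> schedules k qs \<Longrightarrow> Xs @ Ys \<in> schedules k (rs @ qs)"
  by (auto simp: schedules_def nth_append)

lemma schedules_take_drop:
  assumes "Xs \<in> schedules k (rs @ qs)"
  shows "take (length rs) Xs \<in> schedules k rs" "drop (length rs) Xs \<in> schedules k qs"
proof -
  have len: "length Xs = length rs + length qs"
    and nth: "\<And>t. t < length rs + length qs \<Longrightarrow> Xs ! t \<in> configs k \<and> (rs @ qs) ! t \<in> Xs ! t"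
    using assms by (auto simp: schedules_def)
  have "Xs ! t \<in> configs k \<and> rs ! t \<in> Xs ! t" if "t < length rs" for t
    using nth[of t] that by (simp add: nth_append)
  then show "take (length rs) Xs \<in> schedules k rs" by (simp add: schedules_def len)
  have "Xs ! (length rs + t) \<in> configs k \<and> qs ! t \<in> Xs ! (length rs + t)"
    if "t < length qs" for t
    using nth[of "length rs + t"] that by simp
  then show "drop (length rs) Xs \<in> schedules k qs" by (simp add: schedules_def len)
qed

lemma schedules_replicate:
  "X \<in> configs k \<Longrightarrow> set rs \<subseteq> X \<Longrightarrow> replicate (length rs) X \<in> schedules k rs"
  by (auto simp: schedules_def)

lemma cost_append: "cost C (Xs @ Ys) = cost C Xs + cost (last (C # Xs)) Ys"
  by (induction Xs arbitrary: C) auto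

lemma cost_replicate_le: "cost X (replicate n Y) \<le> config_dist X Y"
proof -
  have "cost Y (replicate m Y) = 0" for m
    by (induction m) (auto simp: config_dist_def)
  then show ?thesis by (cases n) auto
qed

lemma cost_le:
  assumes "C \<in> configs k" "set Xs \<subseteq> configs k"
  shows "cost C Xs \<le> k * length Xs"
  using assms
proof (induction Xs arbitrary: C)
  case (Cons X Xs)
  then have "cost X Xs \<le> k * length Xs" by simp
  moreover have "config_dist C X \<le> k"
    using configs_card_Diff_le Cons.prems(1) by (simp add: config_dist_def)
  ultimately show ?case by simp
qed simp

text \<open>Configurations have equal size, so a move evicts as many pages as it loads. The cost
  therefore also counts loads, and every page outside \<open>C\<close> that ever occurs has to be
  loaded at least once.\<close>

lemma cost_ge_new_pages:
  assumes "C \<in> configs k" "set Xs \<subseteq> configs k"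
  shows "card (\<Union> (set Xs) - C) \<le> cost C Xs"
  using assms
proof (induction Xs arbitrary: C)
  case (Cons X Xs)
  have fin: "finite (\<Union> (set (X # Xs)))"
    using Cons.prems(2) by (auto simp: configs_def)
  have "card (\<Union> (set (X # Xs)) - C) \<le> card ((X - C) \<union> (\<Union> (set Xs) - X))"
    using fin by (intro card_mono) auto
  also have "\<dots> \<le> card (X - C) + card (\<Union> (set Xs) - X)"
    by (rule card_Un_le)
  also have "\<dots> \<le> card (C - X) + cost X Xs"
    using Cons configs_Diff_card_eq[of X k C] by (auto intro!: add_mono)
  finally show ?case by (simp add: config_dist_def)
qed simp

lemma cost_ge_new_requests:
  assumes "C \<in> configs k" "Xs \<in> schedules k rs"
  shows "card (set rs - C) \<le> cost C Xs"
proof -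
  have "finite (\<Union> (set Xs))"
    using schedules_set[OF assms(2)] by (auto simp: configs_def)
  then have "card (set rs - C) \<le> card (\<Union> (set Xs) - C)"
    using schedules_requests[OF assms(2)] by (intro card_mono) auto
  then show ?thesis
    using cost_ge_new_pages[OF assms(1) schedules_set[OF assms(2)]] by linarith
qed

lemma OPT_le: "Xs \<in> schedules k rs \<Longrightarrow> OPT k C rs \<le> cost C Xs"
  unfolding OPT_def by (rule cINF_lower) auto

lemma optimal_schedule_exists:
  assumes "schedules k rs \<noteq> {}"
  obtains Os where "optimal_schedule k C rs Os"
proof -
  have "OPT k C rs \<in> cost C ` schedules k rs"
    unfolding OPT_def using assms by (intro Inf_nat_def1) auto
  then show thesis using that by (auto simp: optimal_schedule_def)
qed

text \<open>Serves to determine the optimum without computing an infimum: one cheap schedule bounds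
  it from above, the distinct requested pages outside \<open>C\<close> bound it from below.\<close>

lemma OPT_eqI:
  assumes "C \<in> configs k" "Xs \<in> schedules k rs" "cost C Xs \<le> n" "n \<le> card (set rs - C)"
  shows "OPT k C rs = n"
proof (rule antisym)
  show "OPT k C rs \<le> n" using OPT_le[OF assms(2)] assms(3) by (rule order_trans)
  obtain Os where "optimal_schedule k C rs Os"
    using optimal_schedule_exists assms(2) by blast
  then show "n \<le> OPT k C rs"
    using cost_ge_new_requests[OF assms(1), of Os rs] assms(4)
    by (auto simp: optimal_schedule_def)
qed

lemma prediction_error_le:
  assumes "Ps \<in> predictions k rs" "length Os = length rs"
  shows "prediction_error Ps Os \<le> k * length rs"
proof -
  have "prediction_error Ps Os \<le> (\<Sum>t<length Os. k)"
    unfolding prediction_error_def config_dist_def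
    using assms by (intro sum_mono configs_card_Diff_le) (auto simp: predictions_def)
  then show ?thesis using assms by (simp add: mult.commute)
qed

section \<open>Runs on prefixes of the input\<close>

lemma run_steps_length: "Xs \<in> set_pmf (run_steps A k C ins t) \<Longrightarrow> length Xs = t"
  by (induction t arbitrary: Xs) auto

lemma run_steps_take:
  "s \<le> t \<Longrightarrow> map_pmf (take s) (run_steps A k C ins t) = run_steps A k C ins s"
proof (induction t)
  case (Suc t)
  show ?case
  proof (cases "s = Suc t")
    case True
    have "map_pmf (take s) (run_steps A k C ins s) = map_pmf id (run_steps A k C ins s)"
      by (rule map_pmf_cong[OF refl]) (auto dest: run_steps_length)
    then show ?thesis using True by (simp add: map_pmf_id)
  next
    case False
    with Suc.prems have st: "s \<le> t" by simp
    have "map_pmf (take s) (run_steps A k C ins (Suc t)) =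
        bind_pmf (run_steps A k C ins t)
          (\<lambda>Xs. map_pmf (\<lambda>X. take s (Xs @ [X])) (A k C (take (Suc t) ins) Xs))"
      by (simp add: map_bind_pmf pmf.map_comp o_def)
    also have "\<dots> = bind_pmf (run_steps A k C ins t) (\<lambda>Xs. return_pmf (take s Xs))"
      \<comment> \<open>Runs of \<open>t\<close> steps have length \<open>t \<ge> s\<close>, so the
        appended \<open>X\<close> is cut off again and its distribution integrates out.\<close>
      using st by (intro bind_pmf_cong refl) (auto dest!: run_steps_length)
    also have "\<dots> = run_steps A k C ins s"
      using Suc.IH[OF st] by (simp add: map_pmf_def)
    finally show ?thesis .
  qed
qed simp

lemma run_steps_append_inputs:
  "t \<le> length ins \<Longrightarrow> run_steps A k C (ins @ ins') t = run_steps A k C ins t"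
  by (induction t) auto

text \<open>Step \<open>t\<close> sees only the first \<open>Suc t\<close> inputs, so later requests
  cannot influence it. This allows the adversary to choose each request from the distribution of the
  run so far.\<close>

lemma run_append_take:
  assumes "length Ps = length rs" "length Ps' = length rs'"
  shows "map_pmf (take (length rs)) (run A k C (rs @ rs') (Ps @ Ps')) = run A k C rs Ps"
  using assms by (simp add: run_def run_steps_take run_steps_append_inputs)

section \<open>The algorithm under the constant prediction \<open>C\<close>\<close>

context
  fixes A :: caching_algorithm and k :: nat and C :: config
  assumes online: "online_caching_algorithm A" and k_pos: "k \<ge> 1" and C: "C \<in> configs k"
begin

definition blind_run :: "page list \<Rightarrow> config list pmf" where
  "blind_run rs = run A k C rs (replicate (length rs) C)"

definition blind_cost :: "page list \<Rightarrow> real" where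
  "blind_cost rs = expected_cost A k C rs (replicate (length rs) C)"

text \<open>The \<open>C #\<close> covers the empty run, after which the algorithm is still in its
  initial configuration.\<close>

definition miss_prob :: "page list \<Rightarrow> page set \<Rightarrow> real" where
  "miss_prob rs S =
     measure_pmf.expectation (blind_run rs) (\<lambda>Xs. of_bool (\<not> S \<subseteq> last (C # Xs)))"

lemma blind_predictions: "replicate (length rs) C \<in> predictions k rs"
  using C by (auto simp: predictions_def)

lemma blind_run_schedules: "set_pmf (blind_run rs) \<subseteq> schedules k rs"
  using online k_pos C blind_predictions[of rs]
  unfolding online_caching_algorithm_def blind_run_def by blast

lemma blind_cost_eq:
  "blind_cost rs = measure_pmf.expectation (blind_run rs) (\<lambda>Xs. real (cost C Xs))"
  by (simp add: blind_cost_def blind_run_def expected_cost_def)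

lemma integrable_cost: "integrable (measure_pmf (blind_run rs)) (\<lambda>Xs. real (cost C Xs))"
proof (rule measure_pmf.integrable_const_bound[where B = "real (k * length rs)"])
  show "AE Xs in measure_pmf (blind_run rs). norm (real (cost C Xs)) \<le> real (k * length rs)"
    unfolding AE_measure_pmf_iff
  proof
    fix Xs assume "Xs \<in> set_pmf (blind_run rs)"
    then have Xs: "Xs \<in> schedules k rs" using blind_run_schedules by blast
    show "norm (real (cost C Xs)) \<le> real (k * length rs)"
      using cost_le[OF C schedules_set[OF Xs]] schedules_length[OF Xs]
      by (simp flip: of_nat_mult)
  qed
qed simp

lemma integrable_of_bool:
  "integrable (measure_pmf p) (\<lambda>x. of_bool (P x) :: real)"
  by (rule measure_pmf.integrable_const_bound[where B = 1]) auto

lemma blind_run_take: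
  "map_pmf (take (length rs)) (blind_run (rs @ qs)) = blind_run rs"
  unfolding blind_run_def length_append replicate_add
  by (rule run_append_take) auto

lemma last_blind_run:
  "Xs \<in> set_pmf (blind_run rs) \<Longrightarrow> last (C # Xs) \<in> configs k"
  using blind_run_schedules[of rs] schedules_set[of Xs k rs] by (blast intro: last_in_configs[OF C])

text \<open>Both sides become expectations over the longer run, where the inequality holds
  pointwise: a run whose configuration after \<open>rs\<close> lacks a page of \<open>qs\<close>
  pays at least \<open>1\<close> while serving \<open>qs\<close>.\<close>

lemma blind_cost_append_ge: "blind_cost rs + miss_prob rs (set qs) \<le> blind_cost (rs @ qs)"
proof -
  let ?g = "\<lambda>Xs. real (cost C Xs) + of_bool (\<not> set qs \<subseteq> last (C # Xs))"
  have int: "integrable (measure_pmf (blind_run rs)) ?g"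
    by (intro Bochner_Integration.integrable_add integrable_cost integrable_of_bool)
  have "blind_cost rs + miss_prob rs (set qs) = measure_pmf.expectation (blind_run rs) ?g"
    unfolding blind_cost_eq miss_prob_def
    by (intro Bochner_Integration.integral_add[symmetric] integrable_cost integrable_of_bool)
  also have "\<dots> = measure_pmf.expectation (blind_run (rs @ qs)) (\<lambda>Xs. ?g (take (length rs) Xs))"
    by (subst blind_run_take[symmetric, of rs qs]) (rule integral_map_pmf)
  also have "\<dots> \<le> measure_pmf.expectation (blind_run (rs @ qs)) (\<lambda>Xs. real (cost C Xs))"
  proof (rule integral_mono_AE)
    show "integrable (measure_pmf (blind_run (rs @ qs))) (\<lambda>Xs. ?g (take (length rs) Xs))"
      using int by (subst (asm) blind_run_take[symmetric, of rs qs]) (simp only: integrable_map_pmf_eq)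
    show "integrable (measure_pmf (blind_run (rs @ qs))) (\<lambda>Xs. real (cost C Xs))"
      by (rule integrable_cost)
    show "AE Xs in measure_pmf (blind_run (rs @ qs)). ?g (take (length rs) Xs) \<le> real (cost C Xs)"
      unfolding AE_measure_pmf_iff
    proof
      fix Xs assume "Xs \<in> set_pmf (blind_run (rs @ qs))"
      then have Xs: "Xs \<in> schedules k (rs @ qs)" using blind_run_schedules by blast
      let ?Y = "take (length rs) Xs" and ?Z = "drop (length rs) Xs"
      let ?L = "last (C # ?Y)"
      have L: "?L \<in> configs k"
        by (rule last_in_configs[OF C schedules_set[OF schedules_take_drop(1)[OF Xs]]])
      have "of_bool (\<not> set qs \<subseteq> ?L) \<le> card (set qs - ?L)"
        by (auto simp: Suc_le_eq card_gt_0_iff)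
      also have "\<dots> \<le> cost ?L ?Z"
        by (rule cost_ge_new_requests[OF L schedules_take_drop(2)[OF Xs]])
      finally have "cost C ?Y + of_bool (\<not> set qs \<subseteq> ?L) \<le> cost C Xs"
        using cost_append[of C ?Y ?Z] by simp
      then show "?g ?Y \<le> real (cost C Xs)"
        by (metis of_nat_add of_nat_le_iff of_nat_of_bool)
    qed
  qed
  finally show ?thesis by (simp add: blind_cost_eq)
qed

lemma blind_cost_mono: "blind_cost rs \<le> blind_cost (rs @ qs)"
proof -
  have "0 \<le> miss_prob rs (set qs)" unfolding miss_prob_def by (rule Bochner_Integration.integral_nonneg) simp
  then show ?thesis using blind_cost_append_ge[of rs qs] by linarith
qed

text \<open>By pigeonhole, \<open>k\<close> cached pages never cover \<open>U\<close>, so in every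
  outcome at least one of the events summed over occurs.\<close>

lemma sum_miss_prob_ge:
  assumes "finite U" "card U = Suc k" "M \<subset> U"
  shows "1 \<le> (\<Sum>p\<in>U - M. miss_prob rs (insert p M))"
proof -
  have "(1::real) = measure_pmf.expectation (blind_run rs) (\<lambda>_. 1)" by simp
  also have "\<dots> \<le> measure_pmf.expectation (blind_run rs)
      (\<lambda>Xs. \<Sum>p\<in>U - M. of_bool (\<not> insert p M \<subseteq> last (C # Xs)))"
  proof (rule integral_mono_AE)
    show "AE Xs in measure_pmf (blind_run rs).
        1 \<le> (\<Sum>p\<in>U - M. of_bool (\<not> insert p M \<subseteq> last (C # Xs)) :: real)"
      unfolding AE_measure_pmf_iff
    proof
      fix Xs assume "Xs \<in> set_pmf (blind_run rs)"
      then have X: "last (C # Xs) \<in> configs k" by (rule last_blind_run)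
      \<comment> \<open>If \<open>M\<close> is cached completely, the page missing from
        \<open>U\<close> is the witness; otherwise any element of the nonempty \<open>U - M\<close>
        is.\<close>
      have "\<exists>p\<in>U - M. \<not> insert p M \<subseteq> last (C # Xs)"
      proof (cases "M \<subseteq> last (C # Xs)")
        case True
        have "\<not> U \<subseteq> last (C # Xs)"
          using X assms(2) card_mono[of "last (C # Xs)" U] by (auto simp: configs_def)
        with True show ?thesis by blast
      qed (use assms(3) in blast)
      then obtain p where p: "p \<in> U - M" "\<not> insert p M \<subseteq> last (C # Xs)" by blast
      have "of_bool (\<not> insert p M \<subseteq> last (C # Xs)) \<le>
          (\<Sum>p\<in>U - M. of_bool (\<not> insert p M \<subseteq> last (C # Xs)) :: real)"
        using p(1) assms(1) by (intro member_le_sum) auto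
      with p(2) show "1 \<le> (\<Sum>p\<in>U - M. of_bool (\<not> insert p M \<subseteq> last (C # Xs)) :: real)"
        by simp
    qed
  qed (auto intro!: Bochner_Integration.integrable_sum integrable_of_bool)
  also have "\<dots> = (\<Sum>p\<in>U - M. miss_prob rs (insert p M))"
    unfolding miss_prob_def
    by (intro Bochner_Integration.integral_sum integrable_of_bool)
  finally show ?thesis .
qed

section \<open>The adversary and its phases\<close>

text \<open>Averaging: some \<open>p\<close> attains at least the mean of the miss probabilities,
  whose sum is at least \<open>1\<close>.\<close>

lemma ex_costly_extension:
  assumes "finite U" "card U = Suc k" "set ms \<subset> U"
  obtains p where "p \<in> U - set ms"
    "blind_cost rs + 1 / real (card (U - set ms)) \<le> blind_cost (rs @ ms @ [p])"
proof -
  let ?V = "U - set ms"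
  have V: "finite ?V" "?V \<noteq> {}" using assms by auto
  then have pos: "real (card ?V) > 0" by (simp add: card_gt_0_iff)
  have "\<exists>p\<in>?V. 1 / real (card ?V) \<le> miss_prob rs (insert p (set ms))"
  proof (rule ccontr)
    assume "\<not> ?thesis"
    then have "(\<Sum>p\<in>?V. miss_prob rs (insert p (set ms))) < (\<Sum>p\<in>?V. 1 / real (card ?V))"
      using V by (intro sum_strict_mono) (auto simp: not_le)
    then show False using sum_miss_prob_ge[OF assms, of rs] pos by simp
  qed
  then obtain p where p: "p \<in> ?V" "1 / real (card ?V) \<le> miss_prob rs (insert p (set ms))"
    by blast
  moreover have "set (ms @ [p]) = insert p (set ms)" by simp
  ultimately show thesis
    using that[of p] blind_cost_append_ge[of rs "ms @ [p]"] by simp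
qed

text \<open>The set \<open>M\<close> of the phase is \<open>set ws\<close>. Growing it from size
  \<open>1\<close> to \<open>Suc j\<close> gains \<open>1/k + ... + 1/(k - j + 1)\<close>, which is
  the difference of harmonic numbers.\<close>

lemma partial_phase:
  assumes "finite U" "card U = Suc k" "v \<in> U" "j < k"
  shows "\<exists>ws. set ws \<subseteq> U \<and> v \<in> set ws \<and> card (set ws) = Suc j \<and> length ws \<le> (Suc j)^2 \<and>
    blind_cost rs + harm k - harm (k - j) \<le> blind_cost (rs @ ws)"
  using assms(4)
proof (induction j)
  case 0
  then show ?case
    using assms(3) blind_cost_mono[of rs "[v]"] by (intro exI[of _ "[v]"]) simp
next
  case (Suc j)
  then obtain ws where ws: "set ws \<subseteq> U" "v \<in> set ws" "card (set ws) = Suc j"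
      "length ws \<le> (Suc j)^2" "blind_cost rs + harm k - harm (k - j) \<le> blind_cost (rs @ ws)"
    by auto
  \<comment> \<open>A repetition-free list keeps this round at \<open>j + 2\<close> requests, within
    the difference of the squares of \<open>j + 2\<close> and \<open>j + 1\<close>.\<close>
  obtain ms where ms: "set ms = set ws" "distinct ms"
    using finite_distinct_list[of "set ws"] by auto
  have len: "length ms = Suc j" using ms ws(3) distinct_card[of ms] by simp
  have "set ms \<subset> U" using ms ws(1,3) assms(2) Suc.prems by auto
  then obtain p where p: "p \<in> U - set ms"
      "blind_cost (rs @ ws) + 1 / real (card (U - set ms)) \<le> blind_cost ((rs @ ws) @ ms @ [p])"
    using ex_costly_extension[OF assms(1,2)] by blast
  have "card (U - set ms) = k - j"
    using ms(1) ws(1,3) assms(1,2) by (simp add: card_Diff_subset)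
  moreover have "harm (k - j) = harm (k - Suc j) + 1 / real (k - j)"
    using Suc.prems harm_Suc[of "k - Suc j", where 'a = real]
    by (simp add: Suc_diff_Suc inverse_eq_divide del: of_nat_Suc of_nat_diff)
  ultimately have "blind_cost rs + harm k - harm (k - Suc j) \<le> blind_cost (rs @ ws @ ms @ [p])"
    using p(2) ws(5) by simp
  moreover have "card (set (ws @ ms @ [p])) = Suc (Suc j)"
    using p(1) ms(1) ws(3) by simp
  moreover have "length (ws @ ms @ [p]) \<le> (Suc (Suc j))^2"
    using ws(4) len by (simp add: power2_eq_square)
  moreover have "set (ws @ ms @ [p]) \<subseteq> U" "v \<in> set (ws @ ms @ [p])"
    using ws(1,2) ms(1) p(1) by auto
  ultimately show ?case by blast
qed

text \<open>The case \<open>j = k - 1\<close>, where \<open>harm (k - j)\<close> is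
  \<open>1\<close>. The new configuration contains no page outside \<open>D\<close> except
  \<open>v\<close>, hence the offline cost of at most \<open>1\<close>.\<close>

lemma phase:
  assumes "D \<in> configs k" "v \<notin> D"
  obtains ws where "set ws \<in> configs k" "config_dist D (set ws) \<le> 1" "v \<in> set ws"
    "length ws \<le> k^2" "blind_cost rs + (harm k - 1) \<le> blind_cost (rs @ ws)"
proof -
  have U: "finite (insert v D)" "card (insert v D) = Suc k"
    using assms by (auto simp: configs_def)
  obtain ws where ws: "set ws \<subseteq> insert v D" "v \<in> set ws" "card (set ws) = k" "length ws \<le> k^2"
      "blind_cost rs + (harm k - 1) \<le> blind_cost (rs @ ws)"
    using partial_phase[OF U insertI1, of "k - 1" rs] k_pos by (auto simp: harm_def)
  then have M: "set ws \<in> configs k" by (simp add: configs_def)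
  have "card (set ws - D) \<le> card {v}" using ws(1) by (intro card_mono) auto
  then have "config_dist D (set ws) \<le> 1"
    using configs_Diff_card_eq[OF assms(1) M] by (simp add: config_dist_def)
  then show thesis using that M ws by blast
qed

lemma phases:
  "\<exists>rs Xs. Xs \<in> schedules k rs \<and> cost C Xs \<le> n \<and> n \<le> card (set rs - C) \<and>
     length rs \<le> n * k^2 \<and> real n * (harm k - 1) \<le> blind_cost rs"
proof (induction n)
  case 0
  have "blind_cost [] \<ge> 0" unfolding blind_cost_eq by (rule Bochner_Integration.integral_nonneg) simp
  then show ?case by (intro exI[of _ "[]"]) (auto simp: schedules_def)
next
  case (Suc n)
  then obtain rs Xs where IH: "Xs \<in> schedules k rs" "cost C Xs \<le> n" "n \<le> card (set rs - C)"
      "length rs \<le> n * k^2" "real n * (harm k - 1) \<le> blind_cost rs" by blast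
  define D where "D = last (C # Xs)"
  have D: "D \<in> configs k"
    unfolding D_def by (rule last_in_configs[OF C schedules_set[OF IH(1)]])
  have "finite (C \<union> D \<union> set rs)" using C D by (auto simp: configs_def)
  \<comment> \<open>Avoiding \<open>D\<close> gives a set \<open>U\<close> of \<open>k + 1\<close>
    pages; avoiding \<open>C\<close> and \<open>rs\<close> makes the lower bound for the optimum
    grow by one.\<close>
  then obtain v where v: "v \<notin> C \<union> D \<union> set rs"
    using ex_new_if_finite[OF infinite_UNIV_nat] by metis
  obtain ws where ws: "set ws \<in> configs k" "config_dist D (set ws) \<le> 1" "v \<in> set ws"
      "length ws \<le> k^2" "blind_cost rs + (harm k - 1) \<le> blind_cost (rs @ ws)"
    using v by (auto intro: phase[OF D, of v rs])
  \<comment> \<open>The offline player moves at the start of the phase to the set of all pages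
    requested in it and stays there.\<close>
  let ?Ys = "replicate (length ws) (set ws)"
  have "Xs @ ?Ys \<in> schedules k (rs @ ws)"
    using IH(1) schedules_replicate[OF ws(1), of ws] by (simp add: schedules_append)
  moreover have "cost C (Xs @ ?Ys) \<le> Suc n"
    using IH(2) ws(2) cost_replicate_le[of D "length ws" "set ws"]
    unfolding cost_append D_def[symmetric] by linarith
  moreover have "Suc n \<le> card (set (rs @ ws) - C)"
  proof -
    have "Suc n \<le> card (insert v (set rs - C))" using v IH(3) by simp
    also have "\<dots> \<le> card (set (rs @ ws) - C)" using v ws(3) by (intro card_mono) auto
    finally show ?thesis .
  qed
  moreover have "length (rs @ ws) \<le> Suc n * k^2" using IH(4) ws(4) by simp
  moreover have "real (Suc n) * (harm k - 1) \<le> blind_cost (rs @ ws)"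
    using IH(5) ws(5) by (simp add: algebra_simps)
  ultimately show ?case by (intro exI conjI)
qed

end

section \<open>From phases to the growth of \<open>f\<close>\<close>

lemma competitive_ratio_ge_harm:
  assumes online: "online_caching_algorithm A" and ratio: "achieves_competitive_ratio A f"
    and k: "k \<ge> 1" and x: "real k ^ 3 \<le> x"
  shows "harm k - 1 \<le> f x"
proof -
  define C :: config where "C = {..<k}"
  have C: "C \<in> configs k" by (simp add: C_def configs_def)
  obtain \<alpha> where \<alpha>: "\<And>rs Ps Os \<eta>. Ps \<in> predictions k rs \<Longrightarrow> optimal_schedule k C rs Os \<Longrightarrow>
      OPT k C rs > 0 \<Longrightarrow> real (prediction_error Ps Os) \<le> \<eta> \<Longrightarrow>
      expected_cost A k C rs Ps \<le> f (\<eta> / real (OPT k C rs)) * real (OPT k C rs) + \<alpha>"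
    using ratio k C unfolding achieves_competitive_ratio_def by meson
  \<comment> \<open>As \<alpha> is independent of \<open>n\<close>, a bound for all numbers of
    phases forces the factor of \<open>n\<close> to be nonpositive.\<close>
  have bound: "real n * (harm k - 1 - f x) \<le> \<alpha>" if n: "n \<ge> 1" for n
  proof -
    obtain rs Xs where rs: "Xs \<in> schedules k rs" "cost C Xs \<le> n" "n \<le> card (set rs - C)"
        "length rs \<le> n * k^2" "real n * (harm k - 1) \<le> blind_cost A k C rs"
      using phases[OF online k C, of n] by blast
    have opt: "OPT k C rs = n" using OPT_eqI[OF C rs(1-3)] .
    obtain Os where Os: "optimal_schedule k C rs Os"
      using optimal_schedule_exists rs(1) by blast
    let ?Ps = "replicate (length rs) C"
    have Ps: "?Ps \<in> predictions k rs" using C by (auto simp: predictions_def)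
    have "prediction_error ?Ps Os \<le> k * length rs"
      using Os by (intro prediction_error_le[OF Ps]) (auto simp: optimal_schedule_def schedules_def)
    also have "\<dots> \<le> k * (n * k^2)" using rs(4) by simp
    also have "\<dots> = k^3 * n" by (simp add: power2_eq_square power3_eq_cube)
    finally have "real (prediction_error ?Ps Os) \<le> real (k^3 * n)" by (simp only: of_nat_le_iff)
    also have "\<dots> \<le> x * real n" using x by (simp add: mult_right_mono)
    finally have err: "real (prediction_error ?Ps Os) \<le> x * real n" .
    \<comment> \<open>Taking \<open>x * real n\<close> for \<eta>, instead of the actual error,
      makes the argument of \<open>f\<close> exactly \<open>x\<close>.\<close>
    have "expected_cost A k C rs ?Ps \<le> f x * real n + \<alpha>"
      using \<alpha>[OF Ps Os _ err] n by (simp add: opt)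
    then show ?thesis
      using rs(5) by (simp add: blind_cost_def[OF online k C] algebra_simps)
  qed
  show ?thesis
  proof (rule ccontr)
    assume "\<not> ?thesis"
    then have pos: "harm k - 1 - f x > 0" by simp
    obtain n where "\<alpha> < real n * (harm k - 1 - f x)" using ex_less_of_nat_mult[OF pos] by blast
    then have "\<alpha> < real (Suc n) * (harm k - 1 - f x)" using pos by (simp add: algebra_simps)
    then show False using bound[of "Suc n"] by simp
  qed
qed

theorem theorem9:
  fixes A :: caching_algorithm and f :: "real \<Rightarrow> real"
  assumes "online_caching_algorithm A"
    and "achieves_competitive_ratio A f"
  shows "f \<in> \<Omega>(\<lambda>x. ln x)"
\<comment> \<open>The bound obtained is \<open>ln x / 3 - 1\<close>, which is at least
  \<open>ln x / 6\<close> once \<open>ln x \<ge> 6\<close>; hence also the threshold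
  \<open>exp 6\<close>.\<close>
proof (rule landau_omega.bigI[where c = "1/6"])
  show "\<forall>\<^sub>F x in at_top. norm (f x) \<ge> 1/6 * norm (ln x)"
    using eventually_ge_at_top[of "exp 6"]
  proof eventually_elim
    case (elim x)
    have "(1::real) \<le> exp 6" by simp
    then have x1: "1 \<le> x" using elim by linarith
    have lnx: "6 \<le> ln x" using elim x1 by (subst ln_ge_iff) auto
    define y where "y = root 3 x"
    have y: "y \<ge> 1" "y ^ 3 = x" using x1 by (simp_all add: y_def)
    \<comment> \<open>The largest cache size with \<open>k^3 \<le> x\<close>.\<close>
    define k where "k = nat \<lfloor>y\<rfloor>"
    have k: "k \<ge> 1" "real k \<le> y" "y \<le> real k + 1"
      using y(1) by (auto simp: k_def le_nat_iff le_floor_iff)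
    have "real k ^ 3 \<le> x" using k(2) unfolding y(2)[symmetric] by (intro power_mono) auto
    then have "harm k - 1 \<le> f x" using competitive_ratio_ge_harm[OF assms k(1)] by blast
    moreover have "ln x / 3 \<le> harm k"
    proof -
      have "ln x / 3 = ln y" using y(1) unfolding y(2)[symmetric] by (simp add: ln_realpow)
      also have "\<dots> \<le> ln (real k + 1)" using y(1) k(3) by simp
      also have "\<dots> \<le> harm k" by (rule ln_le_harm)
      finally show ?thesis .
    qed
    ultimately show ?case using lnx by simp
  qed
qed simp

end
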